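(* Let $n\ge 1$ and $k\ge1$ be integers. The number of compositions of the graph $P_n^2$ with exactly $k$ components is $\binom{n+k-2}{n-k}$, and the total number of compositions of $P_n^2$ is $F_{2n-1}$, where $F_1=F_2=1$, $F_{j+1}=F_j+F_{j-1}$ are the Fibonacci numbers.
   Context: $P_n^2$ is the graph with vertex set $\{1,\dots,n\}$ in which $i$ and $j$ are adjacent iff $1\le |i-j|\le 2$ (the square of the path $P_n$). A composition of a graph $G$ with $k$ components is a partition of its vertex set into $k$ blocks, each inducing a connected subgraph of $G$. *)

theory Defs
  imports
    "Graph_Theory.Graph_Theory"
    "HOL-Library.Disjoint_Sets"
    "HOL-Number_Theory.Fib"
begin

text \<open>Graphs are the symmetric digraphs of the AFP graph library: each undirected edge is
  represented by the two arcs \<open>(i, j)\<close> and \<open>(j, i)\<close>.\<close>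

definition path_square :: "nat \<Rightarrow> nat pair_pre_digraph" where
  "path_square n = \<lparr> pverts = {1..n},
     parcs = {(i, j). i \<in> {1..n} \<and> j \<in> {1..n} \<and>
                      1 \<le> \<bar>int i - int j\<bar> \<and> \<bar>int i - int j\<bar> \<le> 2} \<rparr>"

lemma pair_graph_path_square: "pair_graph (path_square n)"
proof
  have "parcs (path_square n) \<subseteq> {1..n} \<times> {1..n}"
    by (auto simp: path_square_def)
  then show "finite (parcs (path_square n))"
    by (rule finite_subset) simp
qed (auto simp: path_square_def symmetric_def sym_def)

definition graph_compositions :: "('a, 'b) pre_digraph \<Rightarrow> 'a set set set" where
  "graph_compositions G =
     {P. partition_on (verts G) P \<and> (\<forall>B \<in> P. Digraph_Component.connected (G \<restriction> B))}"

text \<open>Binomial coefficient whose lower index may be negative, with value 0 in that case.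
  With truncated subtraction on \<^typ>\<open>nat\<close>, \<open>m choose (n - k)\<close> would be 1 for \<open>k > n\<close>.\<close>

definition choose_int :: "nat \<Rightarrow> int \<Rightarrow> nat" where
  "choose_int m j = (if j < 0 then 0 else m choose nat j)"

end

theory Submission
  imports Defs
begin

text \<open>A block is connected in the square of a path iff it never skips two consecutive vertices
  between two of its elements. Hence vertex \<open>n + 1\<close> extends a composition of \<open>P\<^sub>n\<^sup>2\<close> as a new
  singleton, in the block of \<open>n\<close>, or in the block of \<open>n - 1\<close> when that is a different block.
  If \<open>c n k\<close> counts all compositions with \<open>k\<close> components and \<open>d n k\<close> those separating
  \<open>n - 1\<close> from \<open>n\<close>, this gives \<open>c (n + 1) k = c n k + d (n + 1) k\<close> and
  \<open>d (n + 1) k = c n (k - 1) + d n k\<close>, which Pascal's rule solves by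
  \<open>c n k = (n + k - 2) choose (n - k)\<close> and \<open>d n k = (n + k - 3) choose (n - k)\<close> for \<open>n \<ge> 2\<close>.
  Ignoring \<open>k\<close>, it is the Fibonacci recursion, with totals \<open>F\<^bsub>2n-1\<^esub>\<close> and \<open>F\<^bsub>2n-2\<^esub>\<close>.\<close>

section \<open>Connected vertex sets in the square of a path\<close>

definition gapless :: "nat set \<Rightarrow> bool" where
  "gapless B \<longleftrightarrow> (\<forall>x\<in>B. \<forall>y\<in>B. x < y \<longrightarrow> Suc x \<in> B \<or> Suc (Suc x) \<in> B)"

text \<open>Climb from \<open>x\<close> towards \<open>y\<close> by steps of length 1 or 2 inside
  \<open>B\<close>; the distance \<open>y - x\<close> shrinks each time.\<close>

lemma gapless_imp_reachable:
  assumes "gapless B" "x \<in> B" "y \<in> B" "x \<le> y"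
    and "\<And>u v. u \<in> B \<Longrightarrow> v \<in> B \<Longrightarrow> u < v \<Longrightarrow> v \<le> Suc (Suc u) \<Longrightarrow> (u, v) \<in> r"
  shows "(x, y) \<in> rtrancl_on B r"
  using assms(2,4)
proof (induction "y - x" arbitrary: x rule: less_induct)
  case less
  show ?case
  proof (cases "x = y")
    case True
    then show ?thesis using less.prems by simp
  next
    case False
    then have xy: "x < y" using less.prems by simp
    have "\<exists>z\<in>B. x < z \<and> z \<le> Suc (Suc x) \<and> z \<le> y"
    proof (cases "Suc x \<in> B")
      case True
      then show ?thesis using xy by (intro bexI[of _ "Suc x"]) auto
    next
      case False
      then have "Suc (Suc x) \<in> B" using assms(1,3) less.prems(1) xy by (auto simp: gapless_def)
      \<comment> \<open>A step of length 2 is taken only when \<open>Suc x\<close> is missing, so it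
        cannot overshoot \<open>y\<close>.\<close>
      moreover have "y \<noteq> Suc x" using False assms(3) by auto
      ultimately show ?thesis using xy by (intro bexI[of _ "Suc (Suc x)"]) auto
    qed
    then obtain z where z: "z \<in> B" "x < z" "z \<le> Suc (Suc x)" "z \<le> y" by blast
    have "(z, y) \<in> rtrancl_on B r" using z xy by (intro less.hyps) auto
    then show ?thesis
      using assms(5)[OF less.prems(1) z(1-3)] less.prems(1)
      by (auto intro: converse_rtrancl_on_into_rtrancl_on)
  qed
qed

lemma reachable_imp_gapless_step:
  assumes "(x, y) \<in> rtrancl_on B r" "x < y"
    and "\<And>u v. (u, v) \<in> r \<Longrightarrow> v \<le> Suc (Suc u)"
  shows "Suc x \<in> B \<or> Suc (Suc x) \<in> B"
proof (rule ccontr)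
  assume no: "\<not> ?thesis"
  \<comment> \<open>Invariant of the walk: from a vertex at most \<open>x\<close> an arc reaches at
    most \<open>Suc (Suc x)\<close>, and the two values above \<open>x\<close> are missing from
    \<open>B\<close>.\<close>
  have "y \<le> x"
    using assms(1)
  proof (induction rule: rtrancl_on_induct)
    case (step y z)
    then have "z \<le> Suc (Suc x)" using assms(3)[of y z] by simp
    moreover have "z \<noteq> Suc x" "z \<noteq> Suc (Suc x)" using step.hyps no by auto
    ultimately show ?case by simp
  qed simp
  then show False using assms(2) by simp
qed

lemma connected_path_square_iff:
  assumes "B \<subseteq> {1..n}" "B \<noteq> {}"
  shows "Digraph_Component.connected (with_proj (path_square n) \<restriction> B) \<longleftrightarrow> gapless B"
proof -
  \<comment> \<open>Connectivity is defined as strong connectivity of the symmetric closure, so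
    \<open>r\<close> is the arc relation of that closure. It also demands a nonempty vertex set,
    whence \<open>B \<noteq> {}\<close>.\<close>
  define r where "r = arcs_ends (with_proj (mk_symmetric (with_proj (path_square n) \<restriction> B)))"
  have r: "(u, v) \<in> r \<longleftrightarrow> u \<in> B \<and> v \<in> B \<and> u \<noteq> v \<and> u \<le> Suc (Suc v) \<and> v \<le> Suc (Suc u)" for u v
  proof -
    have "(u, v) \<in> r \<longleftrightarrow> u \<in> B \<and> v \<in> B \<and>
        ((u, v) \<in> parcs (path_square n) \<or> (v, u) \<in> parcs (path_square n))"
      unfolding r_def by (auto simp: parcs_mk_symmetric)
    moreover have "(u, v) \<in> parcs (path_square n) \<longleftrightarrow> u \<noteq> v \<and> u \<le> Suc (Suc v) \<and> v \<le> Suc (Suc u)"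
      if "u \<in> B" "v \<in> B" for u v
    proof -
      have "u \<in> {1..n}" "v \<in> {1..n}" using assms(1) that by auto
      then show ?thesis by (auto simp: path_square_def)
    qed
    ultimately show ?thesis by blast
  qed
  have conn: "Digraph_Component.connected (with_proj (path_square n) \<restriction> B)
      \<longleftrightarrow> (\<forall>u\<in>B. \<forall>v\<in>B. (u, v) \<in> rtrancl_on B r)"
    using assms(2)
    by (auto simp: Digraph_Component.connected_def strongly_connected_def reachable_def r_def)
  have inv: "r\<inverse> = r" using r by auto
  show ?thesis
  proof
    assume "Digraph_Component.connected (with_proj (path_square n) \<restriction> B)"
    then show "gapless B"
      unfolding conn gapless_def using reachable_imp_gapless_step[of _ _ B r] r by blast
  next
    assume g: "gapless B"
    have up: "(u, v) \<in> rtrancl_on B r" if "u \<in> B" "v \<in> B" "u \<le> v" for u v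
      using gapless_imp_reachable[OF g that, of r] r by simp
    have "(u, v) \<in> rtrancl_on B r" if "u \<in> B" "v \<in> B" for u v
    proof (cases "u \<le> v")
      case False
      then have "(v, u) \<in> rtrancl_on B (r\<inverse>)" using up[of v u] that inv by simp
      then show ?thesis by (rule rtrancl_on_converseD)
    qed (use up that in blast)
    then show "Digraph_Component.connected (with_proj (path_square n) \<restriction> B)"
      unfolding conn by blast
  qed
qed

section \<open>Adding an element to a set partition and removing it\<close>

definition join :: "'a \<Rightarrow> 'a \<Rightarrow> 'a set set \<Rightarrow> 'a set set" where
  "join m x P = (\<lambda>B. if x \<in> B then insert m B else B) ` P"

text \<open>A block \<open>{m}\<close> would become empty, which is why singletons are handled
  separately below.\<close>

definition remove_elem :: "'a \<Rightarrow> 'a set set \<Rightarrow> 'a set set" where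
  "remove_elem m P = (\<lambda>B. B - {m}) ` P"

lemma partition_on_same_block:
  "partition_on A P \<Longrightarrow> B \<in> P \<Longrightarrow> C \<in> P \<Longrightarrow> x \<in> B \<Longrightarrow> x \<in> C \<Longrightarrow> B = C"
  unfolding partition_on_def disjoint_def by blast

lemma partition_on_obtain_block:
  assumes "partition_on A P" "x \<in> A"
  obtains B where "B \<in> P" "x \<in> B"
  using assms unfolding partition_on_def by blast

lemma remove_elem_join:
  assumes "m \<notin> \<Union>P"
  shows "remove_elem m (join m x P) = P"
proof -
  have "(\<lambda>B. (if x \<in> B then insert m B else B) - {m}) ` P = id ` P"
    using assms by (intro image_cong) auto
  then show ?thesis by (simp only: remove_elem_def join_def image_image image_id id_apply)
qed

lemma card_join:
  assumes "m \<notin> \<Union>P"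
  shows "card (join m x P) = card P"
proof -
  have "inj_on (\<lambda>B. if x \<in> B then insert m B else B) P"
    using assms by (intro inj_on_inverseI[where g = "\<lambda>B. B - {m}"]) auto
  then show ?thesis unfolding join_def by (rule card_image)
qed

lemma partition_on_join:
  assumes "partition_on A P" "m \<notin> A" "x \<in> A"
  shows "partition_on (insert m A) (join m x P)"
proof (rule partition_onI)
  show "\<Union> (join m x P) = insert m A"
    using assms unfolding partition_on_def join_def by (auto split: if_splits)
  show "{} \<notin> join m x P"
    using assms unfolding partition_on_def join_def by auto
next
  fix B C assume "B \<in> join m x P" "C \<in> join m x P" "B \<noteq> C"
  then obtain B' C' where BC: "B' \<in> P" "C' \<in> P" "B = (if x \<in> B' then insert m B' else B')"
    "C = (if x \<in> C' then insert m C' else C')" "B' \<noteq> C'"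
    unfolding join_def by fast
  have "B' \<inter> C' = {}" using assms(1) BC unfolding partition_on_def disjoint_def by blast
  moreover have "m \<notin> B'" "m \<notin> C'" using assms BC unfolding partition_on_def by auto
  ultimately show "disjnt B C" using BC(3,4) by (auto simp: disjnt_def)
qed

text \<open>The companion \<open>x\<close> of \<open>m\<close> keeps the trimmed block nonempty and
  marks the block to which \<open>m\<close> has to return.\<close>

lemma remove_elem_partition:
  assumes P: "partition_on (insert m A) P" and "m \<notin> A" and B: "B \<in> P" "m \<in> B" "x \<in> B" "x \<noteq> m"
  shows "partition_on A (remove_elem m P)" and "join m x (remove_elem m P) = P"
proof -
  show "partition_on A (remove_elem m P)"
  proof (rule partition_onI)
    show "\<Union> (remove_elem m P) = A"
      using P assms(2) unfolding partition_on_def remove_elem_def by auto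
    have "C - {m} \<noteq> {}" if "C \<in> P" for C
    proof (cases "m \<in> C")
      case True
      then have "C = B" using partition_on_same_block[OF P that B(1)] B by blast
      then show ?thesis using B by blast
    next
      case False
      then show ?thesis using P that by (auto simp: partition_on_def)
    qed
    then show "{} \<notin> remove_elem m P" unfolding remove_elem_def by auto
  next
    fix C D assume "C \<in> remove_elem m P" "D \<in> remove_elem m P" "C \<noteq> D"
    then show "disjnt C D"
      using partition_on_same_block[OF P] unfolding remove_elem_def disjnt_def by blast
  qed
  have "(if x \<in> C - {m} then insert m (C - {m}) else C - {m}) = C" if "C \<in> P" for C
    using partition_on_same_block[OF P that B(1)] B by auto
  then show "join m x (remove_elem m P) = P"
    unfolding join_def remove_elem_def image_image by simp
qed

lemma partition_on_insert_singleton: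
  assumes "partition_on A P" "m \<notin> A"
  shows "partition_on (insert m A) (insert {m} P)"
  using assms unfolding partition_on_def disjoint_def by blast

lemma partition_on_remove_singleton:
  assumes "partition_on (insert m A) P" "m \<notin> A" "{m} \<in> P"
  shows "partition_on A (P - {{m}})"
proof -
  have "m \<notin> B" if "B \<in> P" "B \<noteq> {m}" for B
    using partition_on_same_block[OF assms(1) that(1) assms(3)] that by blast
  then have "\<Union> (P - {{m}}) = \<Union>P - {m}" by fast
  also have "\<dots> = A" using assms(1,2) by (simp add: partition_on_def)
  finally have "\<Union> (P - {{m}}) = A" .
  moreover have "disjoint (P - {{m}})" "{} \<notin> P - {{m}}"
    using assms(1) unfolding partition_on_def by (auto intro: pairwise_subset)
  ultimately show ?thesis unfolding partition_on_def by simp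
qed

section \<open>Gapless blocks at the right end of the path\<close>

lemma gapless_Diff_last:
  assumes "gapless B" "B \<subseteq> {1..Suc n}"
  shows "gapless (B - {Suc n})"
  unfolding gapless_def
proof (intro ballI impI)
  fix x y assume xy: "x \<in> B - {Suc n}" "y \<in> B - {Suc n}" "x < y"
  then have "y \<le> n" using assms(2) by force
  moreover have "Suc x \<in> B \<or> Suc (Suc x) \<in> B" using assms(1) xy by (auto simp: gapless_def)
  ultimately show "Suc x \<in> B - {Suc n} \<or> Suc (Suc x) \<in> B - {Suc n}"
    \<comment> \<open>If \<open>Suc x\<close> is not \<open>y\<close>, then
      \<open>Suc (Suc x) \<le> y \<le> n\<close>, so neither candidate is the deleted
      \<open>Suc n\<close>.\<close>
    using xy by (cases "Suc x = y") auto
qed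

text \<open>Elements below \<open>x\<close> have a successor in \<open>B\<close> already; those from
  \<open>x\<close> on are \<open>n - 1\<close> or \<open>n\<close>, hence within distance 2 of
  \<open>Suc n\<close>.\<close>

lemma gapless_insert_next:
  assumes "gapless B" "B \<subseteq> {1..n}" "x \<in> B" "n - 1 \<le> x"
  shows "gapless (insert (Suc n) B)"
  unfolding gapless_def
proof (intro ballI impI)
  fix y z assume yz: "y \<in> insert (Suc n) B" "z \<in> insert (Suc n) B" "y < z"
  then have y: "y \<in> B" "y \<le> n" using assms(2) by force+
  show "Suc y \<in> insert (Suc n) B \<or> Suc (Suc y) \<in> insert (Suc n) B"
  proof (cases "y < x")
    case True
    then show ?thesis using assms(1,3) y by (auto simp: gapless_def)
  next
    case False
    then have "y = n \<or> Suc y = n" using y assms(4) by auto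
    then show ?thesis by auto
  qed
qed

text \<open>The largest element of \<open>B\<close> other than \<open>Suc n\<close> must reach
  \<open>Suc n\<close> in one step, and \<open>n\<close> is excluded.\<close>

lemma gapless_penultimate:
  assumes "gapless B" "B \<subseteq> {1..Suc n}" "Suc n \<in> B" "n \<notin> B" "B \<noteq> {Suc n}"
  shows "n - 1 \<in> B" and "1 \<le> n - 1"
proof -
  define y where "y = Max (B - {Suc n})"
  have fin: "finite (B - {Suc n})" using assms(2) by (auto intro: finite_subset)
  moreover have ne: "B - {Suc n} \<noteq> {}" using assms by blast
  ultimately have y: "y \<in> B - {Suc n}" unfolding y_def by (rule Max_in)
  have max: "z \<le> y" if "z \<in> B" "z \<noteq> Suc n" for z
    unfolding y_def using fin that by simp
  have "y < Suc n" using y assms(2) by force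
  then have "Suc y \<in> B \<or> Suc (Suc y) \<in> B" using assms(1,3) y by (auto simp: gapless_def)
  then have "Suc y = Suc n \<or> Suc (Suc y) = Suc n"
    using max[of "Suc y"] max[of "Suc (Suc y)"] by linarith
  then have "y = n - 1" using y assms(4) by auto
  then show "n - 1 \<in> B" using y by blast
  then show "1 \<le> n - 1" using assms(2) by auto
qed

text \<open>The set \<open>S\<close> of admissible block counts lets one recursion serve both the count with
  \<open>k\<close> components, \<open>S = {k}\<close>, and the total count, \<open>S = UNIV\<close>.\<close>

definition compositions :: "nat set \<Rightarrow> nat \<Rightarrow> nat set set set" where
  "compositions S n = {P. partition_on {1..n} P \<and> (\<forall>B\<in>P. gapless B) \<and> card P \<in> S}"

text \<open>For \<open>n = 1\<close> this set is empty, since no block contains \<open>0\<close>.\<close>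

definition split_compositions :: "nat set \<Rightarrow> nat \<Rightarrow> nat set set set" where
  "split_compositions S n = {P \<in> compositions S n. \<exists>B\<in>P. n - 1 \<in> B \<and> n \<notin> B}"

section \<open>Recursive decomposition of compositions by the last vertex\<close>

lemma atLeast1_atMost_Suc: "{1..Suc n} = insert (Suc n) {1..n}"
  by auto

lemma finite_compositions: "finite (compositions S n)"
  by (rule finite_subset[OF _ finitely_many_partition_on[of "{1..n}"]])
    (auto simp: compositions_def)

lemma finite_split_compositions: "finite (split_compositions S n)"
  using finite_compositions by (simp add: split_compositions_def)

lemma compositions_Union: "P \<in> compositions S n \<Longrightarrow> \<Union>P = {1..n}"
  by (simp add: compositions_def partition_on_def)

lemma compositions_block_subset: "P \<in> compositions S n \<Longrightarrow> B \<in> P \<Longrightarrow> B \<subseteq> {1..n}"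
  using compositions_Union by blast

text \<open>Covers both ways of attaching \<open>Suc n\<close> to an old block: \<open>x\<close> is
  \<open>n\<close> or \<open>n - 1\<close>.\<close>

lemma join_compositions:
  assumes P: "P \<in> compositions S n" and x: "x \<in> {1..n}" "n - 1 \<le> x"
  shows "join (Suc n) x P \<in> compositions S (Suc n)"
proof -
  have "partition_on {1..Suc n} (join (Suc n) x P)"
    unfolding atLeast1_atMost_Suc using P x
    by (intro partition_on_join) (auto simp: compositions_def)
  moreover have "card (join (Suc n) x P) = card P"
    using compositions_Union[OF P] by (intro card_join) auto
  moreover have "gapless B" if "B \<in> join (Suc n) x P" for B
    using that gapless_insert_next[OF _ compositions_block_subset[OF P] _ x(2)] P
    by (auto simp: join_def compositions_def)
  ultimately show ?thesis using P by (auto simp: compositions_def)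
qed

lemma remove_elem_compositions:
  assumes P: "P \<in> compositions S (Suc n)" and B: "B \<in> P" "Suc n \<in> B" "x \<in> B" "x \<noteq> Suc n"
  shows "remove_elem (Suc n) P \<in> compositions S n"
    and "join (Suc n) x (remove_elem (Suc n) P) = P"
proof -
  have part: "partition_on (insert (Suc n) {1..n}) P"
    using P unfolding compositions_def atLeast1_atMost_Suc by blast
  have rem: "partition_on {1..n} (remove_elem (Suc n) P)"
    using remove_elem_partition(1)[OF part _ B] by simp
  show join: "join (Suc n) x (remove_elem (Suc n) P) = P"
    using remove_elem_partition(2)[OF part _ B] by simp
  have "Suc n \<notin> \<Union> (remove_elem (Suc n) P)" by (auto simp: remove_elem_def)
  then have "card (remove_elem (Suc n) P) = card P" using card_join join by metis
  moreover have "gapless C" if "C \<in> remove_elem (Suc n) P" for C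
    using that gapless_Diff_last[OF _ compositions_block_subset[OF P]] P
    by (auto simp: remove_elem_def compositions_def)
  ultimately show "remove_elem (Suc n) P \<in> compositions S n"
    using rem P by (auto simp: compositions_def)
qed

lemma inj_on_join: "inj_on (join (Suc n) x) (compositions S n)"
  by (intro inj_on_inverseI[where g = "remove_elem (Suc n)"] remove_elem_join)
    (auto simp: compositions_Union)

text \<open>Either \<open>n\<close> and \<open>Suc n\<close> share a block, and deleting
  \<open>Suc n\<close> is reversible, or they are separated.\<close>

lemma compositions_Suc:
  assumes "n \<ge> 1"
  shows "compositions S (Suc n)
           = join (Suc n) n ` compositions S n \<union> split_compositions S (Suc n)"
proof (intro equalityI subsetI)
  fix P assume P: "P \<in> compositions S (Suc n)"
  then obtain B where B: "B \<in> P" "n \<in> B"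
    using assms partition_on_obtain_block[of "{1..Suc n}" P n] by (auto simp: compositions_def)
  show "P \<in> join (Suc n) n ` compositions S n \<union> split_compositions S (Suc n)"
  proof (cases "Suc n \<in> B")
    case True
    then show ?thesis using remove_elem_compositions[OF P B(1) True B(2)] by force
  next
    case False
    then show ?thesis using P B by (auto simp: split_compositions_def)
  qed
next
  fix P assume "P \<in> join (Suc n) n ` compositions S n \<union> split_compositions S (Suc n)"
  then show "P \<in> compositions S (Suc n)"
    using assms join_compositions[of _ S n n] by (auto simp: split_compositions_def)
qed

lemma card_compositions_Suc:
  assumes "n \<ge> 1"
  shows "card (compositions S (Suc n))
           = card (compositions S n) + card (split_compositions S (Suc n))"
proof -
  have "join (Suc n) n ` compositions S n \<inter> split_compositions S (Suc n) = {}"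
    by (auto simp: split_compositions_def join_def split: if_splits)
  then show ?thesis
    unfolding compositions_Suc[OF assms]
    by (simp add: card_Un_disjoint card_image inj_on_join finite_compositions
        finite_split_compositions)
qed

text \<open>Once separated from \<open>n\<close>, the vertex \<open>Suc n\<close> is a singleton or
  lies with \<open>n - 1\<close>, which was then already separated from \<open>n\<close>. Removing
  the singleton loses one block, hence the preimage of \<open>S\<close> under
  \<open>Suc\<close>.\<close>

lemma split_compositions_Suc:
  assumes "n \<ge> 1"
  shows "split_compositions S (Suc n)
           = insert {Suc n} ` compositions (Suc -` S) n
             \<union> join (Suc n) (n - 1) ` split_compositions S n"
proof (intro equalityI subsetI)
  fix P assume "P \<in> split_compositions S (Suc n)"
  then obtain B where P: "P \<in> compositions S (Suc n)" and B: "B \<in> P" "n \<in> B" "Suc n \<notin> B"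
    by (auto simp: split_compositions_def)
  have part: "partition_on {1..Suc n} P" using P by (simp add: compositions_def)
  obtain A where A: "A \<in> P" "Suc n \<in> A"
    using partition_on_obtain_block[OF part, of "Suc n"] by auto
  have "n \<notin> A" using partition_on_same_block[OF part A(1) B(1), of n] A B by blast
  show "P \<in> insert {Suc n} ` compositions (Suc -` S) n
             \<union> join (Suc n) (n - 1) ` split_compositions S n"
  proof (cases "A = {Suc n}")
    case True
    have "partition_on {1..n} (P - {{Suc n}})"
      using part A unfolding True atLeast1_atMost_Suc
      by (intro partition_on_remove_singleton) auto
    moreover have "Suc (card (P - {{Suc n}})) = card P"
      using A finite_elements[OF _ part] unfolding True by (intro card_Suc_Diff1) auto
    ultimately have "P - {{Suc n}} \<in> compositions (Suc -` S) n"
      using P by (auto simp: compositions_def)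
    moreover have "P = insert {Suc n} (P - {{Suc n}})" using A True by blast
    ultimately show ?thesis by blast
  next
    case False
    have "gapless A" using P A by (simp add: compositions_def)
    note pen = gapless_penultimate[OF this compositions_block_subset[OF P A(1)] A(2) \<open>n \<notin> A\<close> False]
    have "n - 1 \<noteq> Suc n" by simp
    note rem = remove_elem_compositions[OF P A pen(1) this]
    have "A - {Suc n} \<in> remove_elem (Suc n) P" using A by (simp add: remove_elem_def)
    moreover have "n - 1 \<in> A - {Suc n}" "n \<notin> A - {Suc n}" using pen \<open>n \<notin> A\<close> by auto
    ultimately have "remove_elem (Suc n) P \<in> split_compositions S n"
      unfolding split_compositions_def using rem(1) by (intro CollectI conjI bexI) simp_all
    then have "join (Suc n) (n - 1) (remove_elem (Suc n) P)
        \<in> join (Suc n) (n - 1) ` split_compositions S n"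
      by (rule imageI)
    then show ?thesis unfolding rem(2) by (rule UnI2)
  qed
next
  fix P assume "P \<in> insert {Suc n} ` compositions (Suc -` S) n
             \<union> join (Suc n) (n - 1) ` split_compositions S n"
  then show "P \<in> split_compositions S (Suc n)"
  proof
    assume "P \<in> insert {Suc n} ` compositions (Suc -` S) n"
    then obtain Q where Q: "Q \<in> compositions (Suc -` S) n" and P: "P = insert {Suc n} Q" by blast
    have part: "partition_on {1..n} Q" using Q by (simp add: compositions_def)
    obtain B where B: "B \<in> Q" "n \<in> B"
      using partition_on_obtain_block[OF part, of n] assms by auto
    have "{Suc n} \<notin> Q" using compositions_block_subset[OF Q, of "{Suc n}"] by auto
    then have "card P = Suc (card Q)" using finite_elements[OF _ part] P by simp
    moreover have "partition_on {1..Suc n} P"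
      unfolding P atLeast1_atMost_Suc using part by (intro partition_on_insert_singleton) auto
    ultimately have "P \<in> compositions S (Suc n)"
      using Q P by (auto simp: compositions_def gapless_def)
    moreover have "Suc n \<notin> B" using compositions_block_subset[OF Q B(1)] by auto
    ultimately show ?thesis using B P by (auto simp: split_compositions_def)
  next
    assume "P \<in> join (Suc n) (n - 1) ` split_compositions S n"
    then obtain Q B where Q: "Q \<in> compositions S n" and P: "P = join (Suc n) (n - 1) Q"
      and B: "B \<in> Q" "n - 1 \<in> B" "n \<notin> B"
      by (auto simp: split_compositions_def)
    have part: "partition_on {1..n} Q" using Q by (simp add: compositions_def)
    obtain C where C: "C \<in> Q" "n \<in> C"
      using partition_on_obtain_block[OF part, of n] assms by auto
    have "n - 1 \<notin> C" using partition_on_same_block[OF part B(1) C(1), of "n - 1"] B C by blast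
    \<comment> \<open>The block of \<open>n\<close> avoids \<open>n - 1\<close>, so
      \<open>join\<close> leaves it unchanged and \<open>n\<close> stays apart from
      \<open>Suc n\<close>.\<close>
    then have "C \<in> P" using C unfolding P join_def by force
    moreover have "Suc n \<notin> C" using compositions_block_subset[OF Q C(1)] by auto
    moreover have "n - 1 \<in> {1..n}" using compositions_block_subset[OF Q B(1)] B by blast
    then have "P \<in> compositions S (Suc n)" unfolding P using Q by (intro join_compositions) auto
    ultimately show ?thesis using C by (auto simp: split_compositions_def)
  qed
qed

lemma card_split_compositions_Suc:
  assumes "n \<ge> 1"
  shows "card (split_compositions S (Suc n))
           = card (compositions (Suc -` S) n) + card (split_compositions S n)"
proof -
  have sub: "split_compositions S n \<subseteq> compositions S n" by (auto simp: split_compositions_def)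
  have "insert {Suc n} ` compositions (Suc -` S) n
      \<inter> join (Suc n) (n - 1) ` split_compositions S n = {}"
  proof -
    \<comment> \<open>\<open>join\<close> puts \<open>Suc n\<close> only into blocks that contain
      \<open>n - 1\<close>, so it never creates this singleton.\<close>
    have "{Suc n} \<notin> join (Suc n) (n - 1) Q" if "Q \<in> compositions S n" for Q
      using compositions_block_subset[OF that]
      by (fastforce simp: join_def split: if_splits)
    then show ?thesis using sub by blast
  qed
  moreover have "inj_on (insert {Suc n}) (compositions (Suc -` S) n)"
  proof (rule inj_on_inverseI[where g = "\<lambda>P. P - {{Suc n}}"])
    fix P assume "P \<in> compositions (Suc -` S) n"
    then have "{Suc n} \<notin> P" using compositions_block_subset[of P _ n "{Suc n}"] by auto
    then show "insert {Suc n} P - {{Suc n}} = P" by simp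
  qed
  moreover have "inj_on (join (Suc n) (n - 1)) (split_compositions S n)"
    using inj_on_join sub by (rule inj_on_subset)
  ultimately show ?thesis
    unfolding split_compositions_Suc[OF assms]
    by (simp add: card_Un_disjoint card_image finite_compositions finite_split_compositions)
qed

section \<open>Initial values and closed forms\<close>

lemma partition_on_singleton_iff: "partition_on {a} P \<longleftrightarrow> P = {{a}}"
proof
  assume P: "partition_on {a} P"
  then have "B \<subseteq> {a}" "B \<noteq> {}" if "B \<in> P" for B
    using that unfolding partition_on_def by auto
  then have "B = {a}" if "B \<in> P" for B
    using that by (metis subset_singletonD)
  moreover have "P \<noteq> {}" using P by (auto simp: partition_on_def)
  ultimately show "P = {{a}}" by blast
qed (simp add: partition_on_def)

lemma compositions_1: "compositions S 1 = (if 1 \<in> S then {{{1}}} else {})"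
  by (auto simp: compositions_def partition_on_singleton_iff gapless_def)

lemma split_compositions_1: "split_compositions S 1 = {}"
  unfolding split_compositions_def compositions_1 by auto

text \<open>The preimage of \<open>UNIV\<close> under \<open>Suc\<close> is \<open>UNIV\<close>, so
  the two recursions close up and run through consecutive Fibonacci numbers.\<close>

lemma card_compositions_UNIV:
  "card (compositions UNIV (Suc n)) = fib (Suc (2 * n))
   \<and> card (split_compositions UNIV (Suc n)) = fib (2 * n)"
proof (induction n)
  case 0
  show ?case using compositions_1[of UNIV] split_compositions_1[of UNIV] by simp
next
  case (Suc n)
  then show ?case
    using card_compositions_Suc[of "Suc n" UNIV] card_split_compositions_Suc[of "Suc n" UNIV]
    by simp
qed

text \<open>Boundary case: the recursion for one component refers to compositions with zero
  components.\<close>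

lemma compositions_0:
  assumes n: "n \<ge> 1"
  shows "compositions {0} n = {}"
proof -
  have False if P: "P \<in> compositions {0} n" for P
  proof -
    have "partition_on {1..n} P" "card P = 0" using P by (auto simp: compositions_def)
    then have "P = {}" using finite_elements[of "{1..n}" P] by simp
    then show False using compositions_Union[OF P] n by auto
  qed
  then show ?thesis by blast
qed

lemma vimage_Suc_singleton: "Suc -` {Suc k} = {k}"
  by auto

lemma choose_int_Suc: "choose_int (Suc m) j = choose_int m j + choose_int m (j - 1)"
proof (cases "j \<le> 0")
  case False
  then obtain i where "j = int (Suc i)" by (metis not_le zero_less_imp_eq_int gr0_implies_Suc)
  then show ?thesis by (simp add: choose_int_def nat_add_distrib)
qed (auto simp: choose_int_def)

text \<open>Shifting both indices by one avoids the truncated \<open>n + k - 2\<close>. The case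
  \<open>n = 0\<close> is split off because at \<open>n = k = 0\<close> the formula would give 1. As
  the recursion lowers \<open>k\<close>, the induction keeps it arbitrary.\<close>

lemma card_compositions_singleton:
  "card (compositions {Suc k} (Suc n)) = choose_int (n + k) (int n - int k)
   \<and> card (split_compositions {Suc k} (Suc n))
       = (if n = 0 then 0 else choose_int (n + k - 1) (int n - int k))"
proof (induction n arbitrary: k)
  case 0
  show ?case
    using compositions_1[of "{Suc k}"] split_compositions_1[of "{Suc k}"]
    by (simp add: choose_int_def)
next
  case (Suc n)
  have d: "card (split_compositions {Suc k} (Suc (Suc n))) = choose_int (n + k) (int n + 1 - int k)"
  proof (cases k)
    case 0
    have "nat (int n + 1) = Suc n" by simp
    then show ?thesis
      using 0 card_split_compositions_Suc[of "Suc n" "{Suc k}"] Suc.IH[of 0] compositions_0[of "Suc n"]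
      by (simp add: vimage_Suc_singleton choose_int_def binomial_eq_0)
  next
    case k: (Suc i)
    \<comment> \<open>For positive \<open>k\<close> the case distinction disappears: at
      \<open>n = 0\<close> the lower index is negative and both sides are 0.\<close>
    have "(if n = 0 then 0 else choose_int (n + k - 1) (int n - int k))
        = choose_int (n + i) (int n - int i - 1)"
      using k by (auto simp: choose_int_def algebra_simps)
    then show ?thesis
      using card_split_compositions_Suc[of "Suc n" "{Suc k}"] Suc.IH[of k] Suc.IH[of i]
        choose_int_Suc[of "n + i" "int n - int i"] k
      by (simp add: vimage_Suc_singleton)
  qed
  show ?case
    using card_compositions_Suc[of "Suc n" "{Suc k}"] d Suc.IH[of k]
      choose_int_Suc[of "n + k" "int n + 1 - int k"]
    by (simp add: algebra_simps)
qed

section \<open>Transfer to compositions of the graph\<close>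

lemma graph_compositions_path_square:
  "graph_compositions (with_proj (path_square n))
     = {P. partition_on {1..n} P \<and> (\<forall>B\<in>P. gapless B)}"
proof -
  have "Digraph_Component.connected (with_proj (path_square n) \<restriction> B) \<longleftrightarrow> gapless B"
    if "partition_on {1..n} P" "B \<in> P" for P B
    using that by (intro connected_path_square_iff) (auto simp: partition_on_def)
  moreover have "verts (with_proj (path_square n)) = {1..n}" by (simp add: path_square_def)
  ultimately show ?thesis unfolding graph_compositions_def by auto
qed

theorem theorem13:
  fixes n k :: nat
  assumes "n \<ge> 1" and "k \<ge> 1"
  shows "card {P \<in> graph_compositions (with_proj (path_square n)). card P = k}
           = choose_int (n + k - 2) (int n - int k)
       \<and> card (graph_compositions (with_proj (path_square n))) = fib (2 * n - 1)"
proof -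
  \<comment> \<open>Writing \<open>n\<close> and \<open>k\<close> as successors turns the truncated
    subtractions into the shifted indices of the closed forms.\<close>
  obtain m j where mj: "n = Suc m" "k = Suc j" using assms by (cases n; cases k) auto
  have "{P \<in> graph_compositions (with_proj (path_square n)). card P = k} = compositions {k} n"
    "graph_compositions (with_proj (path_square n)) = compositions UNIV n"
    by (auto simp: graph_compositions_path_square compositions_def)
  then show ?thesis
    using card_compositions_singleton[of j m] card_compositions_UNIV[of m] by (simp add: mj)
qed

end
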